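(* Let $q$ be a prime power and let $n \geq 2$ be an integer. The girth of the graph $D(n,q)$ is at least $n+5$ when $n$ is odd, and at least $n+4$ when $n$ is even.
   Context: Let $\mathbb{F}_q$ be the finite field of order $q$, $q$ a prime power. For $n \geq 2$ let $P$ and $L$ be two disjoint copies of $\mathbb{F}_q^n$; elements of $P$ are called points and written $(p)=(p_1,\dots,p_n)$, and elements of $L$ are called lines and written $[\ell]=[\ell_1,\dots,\ell_n]$. The graph $D(n,q)$ is the simple undirected bipartite graph with vertex set $P \sqcup L$ (parts $P$ and $L$) in which the point $(p)$ is adjacent to the line $[\ell]$ if and only if the following $n-1$ equations hold (only those with index at most $n$ are imposed): $$p_2+\ell_2 = p_1\ell_1,\qquad p_3+\ell_3 = p_1\ell_2,$$ and for $4 \leq j \leq n$, $$p_j+\ell_j = \begin{cases} p_{j-2}\,\ell_1 & \text{if } j\equiv 0,1 \pmod 4,\\ p_1\,\ell_{j-2} & \text{if } j \equiv 2,3 \pmod 4.\end{cases}$$ The girth of a graph containing at least one cycle is the length of a shortest cycle in it. *)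

theory Defs
  imports Complex_Main "HOL-Library.FuncSet" "HOL-Library.Cardinality"
    "HOL-Number_Theory.Prime_Powers"
begin

text \<open>A simple graph is a pair of a vertex set and a set of two-element edges.\<close>

type_synonym 'v graph = "'v set \<times> 'v set set"

definition simple_graph :: "'v graph \<Rightarrow> bool" where
  "simple_graph G \<longleftrightarrow> (\<forall>e\<in>snd G. e \<subseteq> fst G \<and> card e = 2)"

text \<open>A cycle is given by its list of distinct vertices in cyclic order; the first vertex is
  not repeated at the end, so the number of edges is the length of the list.\<close>

definition is_cycle :: "'v graph \<Rightarrow> 'v list \<Rightarrow> bool" where
  "is_cycle G c \<longleftrightarrow> 3 \<le> length c \<and> distinct c \<and> set c \<subseteq> fst G \<and>
     (\<forall>i<length c. {c ! i, c ! (Suc i mod length c)} \<in> snd G)"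

text \<open>The value is meaningful only for graphs that contain a cycle.\<close>

definition girth :: "'v graph \<Rightarrow> nat" where
  "girth G = (LEAST k. \<exists>c. is_cycle G c \<and> length c = k)"

text \<open>An \<open>n\<close>-tuple over \<open>'a\<close> is a function on \<open>{1..n}\<close>, extended by \<open>undefined\<close>
  outside of that set, so that coordinates are numbered from 1.\<close>

definition tuples :: "nat \<Rightarrow> (nat \<Rightarrow> 'a) set" where
  "tuples n = {1..n} \<rightarrow>\<^sub>E UNIV"

datatype 'a vertex = Point "nat \<Rightarrow> 'a" | Line "nat \<Rightarrow> 'a"

definition incident :: "nat \<Rightarrow> (nat \<Rightarrow> 'a::field) \<Rightarrow> (nat \<Rightarrow> 'a) \<Rightarrow> bool" where
  "incident n p l \<longleftrightarrow>
     (2 \<le> n \<longrightarrow> p 2 + l 2 = p 1 * l 1) \<and>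
     (3 \<le> n \<longrightarrow> p 3 + l 3 = p 1 * l 2) \<and>
     (\<forall>j\<in>{4..n}. p j + l j =
        (if j mod 4 \<in> {0, 1} then p (j - 2) * l 1 else p 1 * l (j - 2)))"

text \<open>The field is passed as a type argument: \<open>D n TYPE('a)\<close> is \<open>D(n,q)\<close> for \<open>q = CARD('a)\<close>.\<close>

definition D :: "nat \<Rightarrow> 'a::{field,finite} itself \<Rightarrow> 'a vertex graph" where
  "D n _ =
     (Point ` tuples n \<union> Line ` tuples n,
      {{Point p, Line l} | p l. p \<in> tuples n \<and> l \<in> tuples n \<and> incident n p l})"

lemma simple_graph_D: "simple_graph (D n TYPE('a::{field,finite}))"
  by (auto simp: simple_graph_def D_def)

end

theory Submission
  imports Defs "HOL-Computational_Algebra.Formal_Power_Series"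
begin

text \<open>Collect the coordinates of a vertex \<open>v\<close> into two formal power series \<open>T v\<close> in a variable \<open>X\<close>.
  The adjacency equations say that along a walk \<open>v\<^sub>0, v\<^sub>1, ...\<close> both series satisfy
  \<open>T v\<^sub>j\<^sub>+\<^sub>2 = T v\<^sub>j + d\<^sub>j X T v\<^sub>j\<^sub>+\<^sub>1\<close> up to a precision growing with \<open>n\<close>, where \<open>d\<^sub>j\<close> is the
  difference of the first coordinates of \<open>v\<^sub>j\<^sub>+\<^sub>2\<close> and \<open>v\<^sub>j\<close>, nonzero when the walk does not
  backtrack. Going around a cycle of length \<open>2 m\<close> in both directions expresses \<open>T v\<^sub>m\<^sub>+\<^sub>1\<close> in two
  ways through \<open>T v\<^sub>0\<close> and \<open>T v\<^sub>1\<close>. As the two series together form a unitriangular matrix modulo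
  \<open>X\<close>, the coefficients must agree, but one has \<open>X\<close>-degree \<open>m\<close> with leading coefficient the product
  of the \<open>d\<^sub>j\<close> and the other has smaller degree.\<close>

unbundle fps_syntax

section \<open>Three-term recurrences\<close>

text \<open>Continuants in the entries \<open>d j * X\<close>: the starting pairs (1, 0) and (0, 1)
  give the two fundamental solutions, which are polynomials in X.\<close>

fun cont :: "(nat \<Rightarrow> 'a::comm_ring_1) \<Rightarrow> 'a fps \<Rightarrow> 'a fps \<Rightarrow> nat \<Rightarrow> 'a fps" where
  "cont d a b 0 = a"
| "cont d a b (Suc 0) = b"
| "cont d a b (Suc (Suc j)) = cont d a b j + fps_const (d j) * (fps_X * cont d a b (Suc j))"

lemma cont_linear: "cont d a b j = cont d 1 0 j * a + cont d 0 1 j * b"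
  by (induction d a b j rule: cont.induct) (simp_all add: algebra_simps)

text \<open>A step raises the degree by at most one, so the fundamental solutions of index
  \<open>j > 0\<close> have degree below \<open>j\<close>. The bound \<open>0 < k\<close> settles
  \<open>j = 0\<close>, where one of them is the constant 1.\<close>

lemma cont_nth_eq_0:
  assumes "0 < k" "j \<le> k"
  shows "cont d 1 0 j $ k = 0" "cont d 0 1 j $ k = 0"
proof -
  have "0 < k \<Longrightarrow> j \<le> k \<Longrightarrow> cont d 1 0 j $ k = 0 \<and> cont d 0 1 j $ k = 0"
    by (induction j arbitrary: k rule: induct_nat_012) auto
  then show "cont d 1 0 j $ k = 0" "cont d 0 1 j $ k = 0"
    using assms by auto
qed

lemma cont_nth_top: "cont d 0 1 (Suc j) $ j = (\<Prod>i<j. d i)"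
proof (induction j)
  case (Suc j)
  then show ?case
    by (simp add: cont_nth_eq_0 mult.commute)
qed simp

text \<open>Multiplication by X moves coefficients upwards only, so errors above degree
  \<open>N\<close> never come down and no precision is lost from step to step.\<close>

lemma cont_approx:
  assumes rec: "\<And>j i. j + 2 \<le> K \<Longrightarrow> i \<le> N \<Longrightarrow>
      T (Suc (Suc j)) $ i = (T j + fps_const (d j) * (fps_X * T (Suc j))) $ i"
    and "j \<le> K" "i \<le> N"
  shows "T j $ i = cont d (T 0) (T 1) j $ i"
  using assms(2,3)
proof (induction j arbitrary: i rule: induct_nat_012)
  case (ge2 j)
  then show ?case
    using rec[of j i] by simp
qed auto

text \<open>A cyclic sequence of period \<open>2 * m\<close> reaches index \<open>m + 1\<close> from the indices 0 and 1 in two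
  ways, by \<open>m\<close> steps forwards and by \<open>m - 1\<close> steps backwards; comparing them gives a linear
  relation whose top coefficient at \<open>T 1\<close> comes from the forward steps only.\<close>

lemma cyclic_relation:
  fixes d :: "nat \<Rightarrow> 'a::comm_ring_1"
  assumes "0 < m"
  obtains a b where "a $ m = (\<Prod>i<m. d i)"
    and "\<And>T N i. \<lbrakk>\<And>j. T (j + 2 * m) = T j;
          \<And>j i. i \<le> N \<Longrightarrow> T (Suc (Suc j)) $ i = (T j + fps_const (d j) * (fps_X * T (Suc j))) $ i;
          i \<le> N\<rbrakk> \<Longrightarrow> (a * T 1 + b * T 0) $ i = 0"
proof -
  \<comment> \<open>Solving the recurrence for its earliest term flips the sign of \<open>d\<close>;
    the backward step \<open>j\<close>, counted from index \<open>2 * m + 1\<close>, uses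
    \<open>d\<close> at \<open>2 * m - 1 - j\<close>.\<close>
  define e where "e = (\<lambda>j. - d (2 * m - 1 - j))"
  \<comment> \<open>Backwards, the starting values are \<open>T 1\<close> and then
    \<open>T 0\<close>, so the fundamental solutions swap roles. The subtracted part has no term of
    degree \<open>m\<close>, as \<open>0 < m\<close>.\<close>
  let ?a = "cont d 0 1 (Suc m) - cont e 1 0 m"
  let ?b = "cont d 1 0 (Suc m) - cont e 0 1 m"
  have "?a $ m = (\<Prod>i<m. d i)"
    using assms by (simp add: cont_nth_top cont_nth_eq_0 del: cont.simps)
  moreover have "(?a * T 1 + ?b * T 0) $ i = 0"
    if per: "\<And>j. T (j + 2 * m) = T j"
      and rec: "\<And>j i. i \<le> N \<Longrightarrow> T (Suc (Suc j)) $ i = (T j + fps_const (d j) * (fps_X * T (Suc j))) $ i"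
      and i: "i \<le> N" for T N i
  proof -
    have fw: "T (Suc m) $ i = cont d (T 0) (T 1) (Suc m) $ i"
      by (rule cont_approx[where K = "Suc m" and N = N]) (use rec i in auto)
    define T' where "T' = (\<lambda>j. T (2 * m + 1 - j))"
    have "T' m $ i = cont e (T' 0) (T' 1) m $ i"
    proof (rule cont_approx[where K = "2 * m" and N = N])
      fix j i assume "j + 2 \<le> 2 * m" "i \<le> N"
      moreover define k where "k = 2 * m - 1 - j"
      ultimately have "2 * m + 1 - j = Suc (Suc k)" "2 * m + 1 - Suc j = Suc k"
        "2 * m + 1 - Suc (Suc j) = k" by auto
      then show "T' (Suc (Suc j)) $ i = (T' j + fps_const (e j) * (fps_X * T' (Suc j))) $ i"
        using rec[OF \<open>i \<le> N\<close>, of k] by (simp add: T'_def e_def k_def)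
    qed (use i in auto)
    moreover have "T' 0 = T 1" "T' 1 = T 0" "T' m = T (Suc m)"
      using per[of 1] per[of 0] by (auto simp: T'_def)
    ultimately have "cont d (T 0) (T 1) (Suc m) $ i = cont e (T 1) (T 0) m $ i"
      using fw by simp
    then have "(cont d (T 0) (T 1) (Suc m) - cont e (T 1) (T 0) m) $ i = 0"
      by simp
    moreover have "cont d (T 0) (T 1) (Suc m) - cont e (T 1) (T 0) m = ?a * T 1 + ?b * T 0"
      by (subst (1 2) cont_linear) (simp add: algebra_simps del: cont.simps)
    ultimately show ?thesis by metis
  qed
  ultimately show thesis
    by (rule that)
qed

text \<open>At the first degree where \<open>a\<close> or \<open>b\<close> might not vanish, only
  the constant terms of the other factors matter, and these form the identity matrix. At degree
  \<open>m\<close> the first relation alone gives \<open>a\<close>, so the second may stop one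
  degree earlier.\<close>

lemma fps_unitriangular_top_eq_0:
  fixes a b R S R' S' :: "'a::comm_ring_1 fps"
  assumes A: "\<And>i. i \<le> m \<Longrightarrow> (a * R + b * S) $ i = 0"
    and B: "\<And>i. i < m \<Longrightarrow> (a * R' + b * S') $ i = 0"
    and [simp]: "R $ 0 = 1" "S $ 0 = 0" "R' $ 0 = 0" "S' $ 0 = 1"
  shows "a $ m = 0"
proof -
  have top: "(f * g) $ j = f $ j * g $ 0" if "\<And>i. i < j \<Longrightarrow> f $ i = 0" for f g :: "'a fps" and j
  proof -
    have "(f * g) $ j = (\<Sum>i=0..j. f $ i * g $ (j - i))"
      by (rule fps_mult_nth)
    also have "\<dots> = (\<Sum>i\<in>{j}. f $ i * g $ (j - i))"
      by (rule sum.mono_neutral_right) (use that in auto)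
    finally show ?thesis by simp
  qed
  have zero: "j < m \<Longrightarrow> a $ j = 0 \<and> b $ j = 0" for j
  proof (induction j rule: less_induct)
    case (less j)
    then have "a $ i = 0" "b $ i = 0" if "i < j" for i
      using that by auto
    then show ?case
      using A[of j] B[of j] less.prems by (simp add: top)
  qed
  then show ?thesis
    using A[of m] by (simp add: top)
qed

section \<open>Incidence\<close>

text \<open>Absorbs the exceptional indices 2 and 3, so that all adjacency equations form one family
  to induct over.\<close>

definition rhs :: "(nat \<Rightarrow> 'a::field) \<Rightarrow> (nat \<Rightarrow> 'a) \<Rightarrow> nat \<Rightarrow> 'a" where
  "rhs p l j = (if j = 2 then p 1 * l 1 else if j = 3 then p 1 * l 2
     else if j mod 4 \<in> {0, 1} then p (j - 2) * l 1 else p 1 * l (j - 2))"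

lemma incident_iff: "incident n p l \<longleftrightarrow> (\<forall>j\<in>{2..n}. p j + l j = rhs p l j)"
proof -
  have "(\<forall>j\<in>{2..n}. P j) \<longleftrightarrow> (2 \<le> n \<longrightarrow> P 2) \<and> (3 \<le> n \<longrightarrow> P 3) \<and> (\<forall>j\<in>{4..n}. P j)" for P
  proof (intro iffI ballI)
    fix j assume P: "(2 \<le> n \<longrightarrow> P 2) \<and> (3 \<le> n \<longrightarrow> P 3) \<and> (\<forall>j\<in>{4..n}. P j)" and "j \<in> {2..n}"
    then consider "j = 2" "2 \<le> n" | "j = 3" "3 \<le> n" | "j \<in> {4..n}" by force
    then show "P j" using P by cases auto
  qed auto
  note * = this[of "\<lambda>j. p j + l j = rhs p l j"]
  show ?thesis
    unfolding * incident_def by (auto simp: rhs_def)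
qed

text \<open>The system is triangular: each right-hand side involves earlier coordinates only.
  Uniqueness and existence of neighbours both rest on this.\<close>

lemma rhs_cong:
  assumes "\<And>i. 1 \<le> i \<Longrightarrow> i < j \<Longrightarrow> p i = p' i" "\<And>i. 1 \<le> i \<Longrightarrow> i < j \<Longrightarrow> l i = l' i" "2 \<le> j"
  shows "rhs p l j = rhs p' l' j"
  using assms by (auto simp: rhs_def)

section \<open>Vertices and edges of the graph\<close>

fun coord :: "'a vertex \<Rightarrow> nat \<Rightarrow> 'a" where
  "coord (Point p) = p"
| "coord (Line l) = l"

fun is_point :: "'a vertex \<Rightarrow> bool" where
  "is_point (Point p) = True"
| "is_point (Line l) = False"

lemma tuples_eqI:
  assumes "f \<in> tuples n" "g \<in> tuples n" "\<And>i. 1 \<le> i \<Longrightarrow> i \<le> n \<Longrightarrow> f i = g i"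
  shows "f = g"
  using assms unfolding tuples_def by (intro PiE_ext[of f "{1..n}" "\<lambda>_. UNIV" g]) auto

lemma D_edge_iff:
  "{u, v} \<in> snd (D n TYPE('a::{field,finite})) \<longleftrightarrow>
     (\<exists>p\<in>tuples n. \<exists>l\<in>tuples n. incident n p l \<and>
        (u = Point p \<and> v = Line l \<or> u = Line l \<and> v = Point p))"
  by (auto simp: D_def doubleton_eq_iff)

lemma D_edge_parity:
  "{u, v} \<in> snd (D n TYPE('a::{field,finite})) \<Longrightarrow> is_point u \<longleftrightarrow> \<not> is_point v"
  by (auto simp: D_edge_iff)

text \<open>For fixed \<open>v\<close>, the triangular system determines a neighbour from its first
  coordinate. Hence non-backtracking makes every \<open>d j\<close> nonzero.\<close>

lemma D_neighbour_unique:
  assumes uv: "{u, v} \<in> snd (D n TYPE('a::{field,finite}))"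
    and vw: "{v, w} \<in> snd (D n TYPE('a))"
    and eq: "coord u 1 = coord w 1"
  shows "u = w"
proof -
  have agree: "f i = g i"
    if "\<And>j. 2 \<le> j \<Longrightarrow> j \<le> n \<Longrightarrow> (\<And>i. 1 \<le> i \<Longrightarrow> i < j \<Longrightarrow> f i = g i) \<Longrightarrow> f j = g j"
      "f 1 = g 1" "1 \<le> i" "i \<le> n" for f g :: "nat \<Rightarrow> 'a" and i
    using that(3,4)
  proof (induction i rule: less_induct)
    case (less i)
    then show ?case
      using that(1)[of i] that(2) by (cases "i = 1") auto
  qed
  show ?thesis
  proof (cases v)
    case (Line l)
    then obtain p p' where p: "u = Point p" "w = Point p'" "p \<in> tuples n" "p' \<in> tuples n"
      "incident n p l" "incident n p' l"
      using uv vw by (auto simp: D_edge_iff)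
    have "p i = p' i" if "1 \<le> i" "i \<le> n" for i
    proof (rule agree[OF _ _ that])
      fix j assume j: "2 \<le> j" "j \<le> n" and IH: "\<And>i. 1 \<le> i \<Longrightarrow> i < j \<Longrightarrow> p i = p' i"
      have "rhs p l j = rhs p' l j" using j IH by (intro rhs_cong) auto
      then have "p j + l j = p' j + l j" using p(5,6) j by (simp add: incident_iff)
      then show "p j = p' j" by simp
    qed (use eq p in simp)
    then show ?thesis using p tuples_eqI by blast
  next
    case (Point p)
    then obtain l l' where l: "u = Line l" "w = Line l'" "l \<in> tuples n" "l' \<in> tuples n"
      "incident n p l" "incident n p l'"
      using uv vw by (auto simp: D_edge_iff)
    have "l i = l' i" if "1 \<le> i" "i \<le> n" for i
    proof (rule agree[OF _ _ that])
      fix j assume j: "2 \<le> j" "j \<le> n" and IH: "\<And>i. 1 \<le> i \<Longrightarrow> i < j \<Longrightarrow> l i = l' i"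
      have "rhs p l j = rhs p l' j" using j IH by (intro rhs_cong) auto
      then have "p j + l j = p j + l' j" using l(5,6) j by (simp add: incident_iff)
      then show "l j = l' j" by simp
    qed (use eq l in simp)
    then show ?thesis using l tuples_eqI by blast
  qed
qed

section \<open>Girth\<close>

text \<open>The two series collect the chains of coordinates in which each entry occurs in the equation for
  the next: \<open>p 1\<close>, \<open>l 2\<close>, \<open>p 3\<close>, \<open>l 5\<close>, \<open>p 7\<close>, ... and \<open>l 1\<close>, \<open>p 2\<close>, \<open>l 4\<close>, \<open>p 6\<close>, ... The entry at
  position \<open>i\<close> is the coefficient of degree \<open>i\<close>.\<close>

definition series_odd :: "'a::field vertex \<Rightarrow> 'a fps" where
  "series_odd v = Abs_fps (\<lambda>i. if is_point v = odd i
     then if i = 0 then 1 else coord v (if i \<le> 2 then i else 2 * i - 3) else 0)"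

definition series_even :: "'a::field vertex \<Rightarrow> 'a fps" where
  "series_even v = Abs_fps (\<lambda>i. if is_point v = even i
     then if i = 0 then 1 else coord v (if i \<le> 2 then i else 2 * i - 2) else 0)"

text \<open>Here and in the next three lemmas, the parity of the position fixes the residue modulo 4
  of the coordinate index, and thus which form the equation takes; small indices are the exceptional
  ones.\<close>

lemma rhs_series_odd_point:
  assumes "even i" "1 \<le> i"
  shows "rhs p l (if Suc i \<le> 2 then Suc i else 2 * Suc i - 3)
     = p 1 * l (if i \<le> 2 then i else 2 * i - 3)"
proof -
  obtain k where k: "i = 2 * Suc k" using assms by (metis dvdE mult_0_right not0_implies_Suc not_one_le_zero)
  have "(3 + 4 * k) mod 4 = 3" by simp
  then show ?thesis by (cases k) (auto simp: k rhs_def)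
qed

lemma rhs_series_odd_line:
  assumes "odd i"
  shows "rhs p l (if Suc i \<le> 2 then Suc i else 2 * Suc i - 3)
     = p (if i \<le> 2 then i else 2 * i - 3) * l 1"
proof -
  obtain k where k: "i = 2 * k + 1" using assms by (rule oddE)
  have "(1 + 4 * k) mod 4 = 1" by simp
  then show ?thesis by (cases k) (auto simp: k rhs_def)
qed

lemma rhs_series_even_point:
  assumes "odd i"
  shows "rhs p l (if Suc i \<le> 2 then Suc i else 2 * Suc i - 2)
     = p 1 * l (if i \<le> 2 then i else 2 * i - 2)"
proof -
  obtain k where k: "i = 2 * k + 1" using assms by (rule oddE)
  have "(2 + 4 * k) mod 4 = 2" by presburger
  then show ?thesis by (cases k) (auto simp: k rhs_def)
qed

lemma rhs_series_even_line:
  assumes "even i" "1 \<le> i"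
  shows "rhs p l (if Suc i \<le> 2 then Suc i else 2 * Suc i - 2)
     = p (if i \<le> 2 then i else 2 * i - 2) * l 1"
proof -
  obtain k where k: "i = 2 * Suc k" using assms by (metis dvdE mult_0_right not0_implies_Suc not_one_le_zero)
  have "(4 + 4 * k) mod 4 = 0" by simp
  then show ?thesis by (cases k) (auto simp: k rhs_def)
qed

lemma diff_of_sums:
  fixes x :: "'a::comm_ring"
  assumes "x + y = a * c" "x' + y = b * c"
  shows "x' = x + (b - a) * c"
proof -
  have "x' - x = (x' + y) - (x + y)" by simp
  also have "\<dots> = (b - a) * c" unfolding assms by (simp add: left_diff_distrib)
  finally show ?thesis by (simp add: algebra_simps)
qed

lemma diff_of_sums_commuted:
  fixes x :: "'a::comm_ring"
  assumes "y + x = c * a" "y + x' = c * b"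
  shows "x' = x + (b - a) * c"
  using diff_of_sums[of x y a c x' b] assms by (simp add: add.commute mult.commute)

text \<open>Subtracting the equations of two neighbours of \<open>v\<close> cancels the coordinate
  of \<open>v\<close>. Degree 1 works because lines have constant term 1. The bound on
  \<open>m\<close> keeps the index \<open>2 * i - 3\<close> within \<open>n\<close>.\<close>

lemma series_odd_step:
  assumes uv: "{u, v} \<in> snd (D n TYPE('a::{field,finite}))"
    and vw: "{v, w} \<in> snd (D n TYPE('a))"
    and i: "i \<le> m" "2 * m \<le> n + 3" "2 \<le> n"
  shows "series_odd w $ i =
    (series_odd u + fps_const (coord w 1 - coord u 1) * (fps_X * series_odd v)) $ i"
proof (cases i)
  case 0
  then show ?thesis using D_edge_parity[OF uv] D_edge_parity[OF vw] by (simp add: series_odd_def)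
next
  case (Suc k)
  define j where "j = (if Suc k \<le> 2 then Suc k else 2 * Suc k - 3)"
  have j: "j \<in> {2..n}" if "k \<noteq> 0" using that i Suc by (auto simp: j_def)
  show ?thesis
  proof (cases v)
    case (Line l)
    then obtain p p' where p: "u = Point p" "w = Point p'" "incident n p l" "incident n p' l"
      using uv vw by (auto simp: D_edge_iff)
    have "p j + l j = rhs p l j" "p' j + l j = rhs p' l j" if "k \<noteq> 0"
      using p j[OF that] by (auto simp: incident_iff)
    moreover have "rhs p l j = p 1 * l (if k \<le> 2 then k else 2 * k - 3)"
      "rhs p' l j = p' 1 * l (if k \<le> 2 then k else 2 * k - 3)" if "k \<noteq> 0" "even k"
      using that by (auto simp only: j_def intro!: rhs_series_odd_point)
    ultimately have "p' j = p j + (p' 1 - p 1) * l (if k \<le> 2 then k else 2 * k - 3)"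
      if "k \<noteq> 0" "even k"
      using diff_of_sums[of "p j" "l j" "p 1" _ "p' j" "p' 1"] that by simp
    then show ?thesis
      using Suc p Line by (auto simp: series_odd_def j_def)
  next
    case (Point p)
    then obtain l l' where l: "u = Line l" "w = Line l'" "incident n p l" "incident n p l'"
      using uv vw by (auto simp: D_edge_iff)
    have "p j + l j = rhs p l j" "p j + l' j = rhs p l' j" if "k \<noteq> 0"
      using l j[OF that] by (auto simp: incident_iff)
    moreover have "rhs p l j = p (if k \<le> 2 then k else 2 * k - 3) * l 1"
      "rhs p l' j = p (if k \<le> 2 then k else 2 * k - 3) * l' 1" if "odd k"
      using that by (auto simp only: j_def intro!: rhs_series_odd_line)
    ultimately have "l' j = l j + (l' 1 - l 1) * p (if k \<le> 2 then k else 2 * k - 3)"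
      if "k \<noteq> 0" "odd k"
      using diff_of_sums_commuted[of "p j" "l j" _ "l 1" "l' j" "l' 1"] that by simp
    then show ?thesis
      using Suc l Point by (auto simp: series_odd_def j_def elim: oddE)
  qed
qed

text \<open>As for the odd series, but now points carry the constant term 1, and the index
  \<open>2 * i - 2\<close> costs one unit in the bound.\<close>

lemma series_even_step:
  assumes uv: "{u, v} \<in> snd (D n TYPE('a::{field,finite}))"
    and vw: "{v, w} \<in> snd (D n TYPE('a))"
    and i: "i \<le> m" "2 * m \<le> n + 2" "2 \<le> n"
  shows "series_even w $ i =
    (series_even u + fps_const (coord w 1 - coord u 1) * (fps_X * series_even v)) $ i"
proof (cases i)
  case 0
  then show ?thesis using D_edge_parity[OF uv] D_edge_parity[OF vw] by (simp add: series_even_def)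
next
  case (Suc k)
  define j where "j = (if Suc k \<le> 2 then Suc k else 2 * Suc k - 2)"
  have j: "j \<in> {2..n}" if "k \<noteq> 0" using that i Suc by (auto simp: j_def)
  show ?thesis
  proof (cases v)
    case (Line l)
    then obtain p p' where p: "u = Point p" "w = Point p'" "incident n p l" "incident n p' l"
      using uv vw by (auto simp: D_edge_iff)
    have "p j + l j = rhs p l j" "p' j + l j = rhs p' l j" if "k \<noteq> 0"
      using p j[OF that] by (auto simp: incident_iff)
    moreover have "rhs p l j = p 1 * l (if k \<le> 2 then k else 2 * k - 2)"
      "rhs p' l j = p' 1 * l (if k \<le> 2 then k else 2 * k - 2)" if "odd k"
      using that by (auto simp only: j_def intro!: rhs_series_even_point)
    ultimately have "p' j = p j + (p' 1 - p 1) * l (if k \<le> 2 then k else 2 * k - 2)"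
      if "k \<noteq> 0" "odd k"
      using diff_of_sums[of "p j" "l j" "p 1" _ "p' j" "p' 1"] that by simp
    then show ?thesis
      using Suc p Line by (auto simp: series_even_def j_def elim: oddE)
  next
    case (Point p)
    then obtain l l' where l: "u = Line l" "w = Line l'" "incident n p l" "incident n p l'"
      using uv vw by (auto simp: D_edge_iff)
    have "p j + l j = rhs p l j" "p j + l' j = rhs p l' j" if "k \<noteq> 0"
      using l j[OF that] by (auto simp: incident_iff)
    moreover have "rhs p l j = p (if k \<le> 2 then k else 2 * k - 2) * l 1"
      "rhs p l' j = p (if k \<le> 2 then k else 2 * k - 2) * l' 1" if "k \<noteq> 0" "even k"
      using that by (auto simp only: j_def intro!: rhs_series_even_line)
    ultimately have "l' j = l j + (l' 1 - l 1) * p (if k \<le> 2 then k else 2 * k - 2)"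
      if "k \<noteq> 0" "even k"
      using diff_of_sums_commuted[of "p j" "l j" _ "l 1" "l' j" "l' 1"] that by simp
    then show ?thesis
      using Suc l Point by (auto simp: series_even_def j_def)
  qed
qed

section \<open>Closed walks and cycles\<close>

lemma D_no_short_closed_walk:
  fixes v :: "nat \<Rightarrow> 'a::{field,finite} vertex"
  assumes edge: "\<And>j. {v j, v (Suc j)} \<in> snd (D n TYPE('a))"
    and nonback: "\<And>j. v j \<noteq> v (Suc (Suc j))"
    and per: "\<And>j. v (j + 2 * m) = v j"
    and "is_point (v 0)" "0 < m" "2 \<le> n"
  shows "n + 4 \<le> 2 * m"
proof (rule ccontr)
  assume "\<not> n + 4 \<le> 2 * m"
  then have m: "2 * m \<le> n + 3" by simp
  define d where "d j = coord (v (Suc (Suc j))) 1 - coord (v j) 1" for j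
  have "d j \<noteq> 0" for j
    using D_neighbour_unique[OF edge edge, of j] nonback[of j] by (auto simp: d_def)
  obtain a b where top: "a $ m = (\<Prod>i<m. d i)"
    and rel: "\<And>T N i. \<lbrakk>\<And>j. T (j + 2 * m) = T j;
          \<And>j i. i \<le> N \<Longrightarrow> T (Suc (Suc j)) $ i = (T j + fps_const (d j) * (fps_X * T (Suc j))) $ i;
          i \<le> N\<rbrakk> \<Longrightarrow> (a * T 1 + b * T 0) $ i = 0"
    using cyclic_relation[OF \<open>0 < m\<close>, of d] by blast
  have line: "\<not> is_point (v 1)"
    using D_edge_parity[OF edge[of 0]] \<open>is_point (v 0)\<close> by simp
  have "a $ m = 0"
  proof (rule fps_unitriangular_top_eq_0)
    show "(a * series_odd (v 1) + b * series_odd (v 0)) $ i = 0" if "i \<le> m" for i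
    proof (rule rel[where T = "\<lambda>j. series_odd (v j)" and N = m])
      show "series_odd (v (Suc (Suc j))) $ i =
        (series_odd (v j) + fps_const (d j) * (fps_X * series_odd (v (Suc j)))) $ i"
        if "i \<le> m" for i j
        unfolding d_def using series_odd_step[OF edge edge that m \<open>2 \<le> n\<close>] .
    qed (use per that in auto)
    \<comment> \<open>Since \<open>2 * m\<close> may equal \<open>n + 3\<close>, the even series is
      only guaranteed up to degree \<open>m - 1\<close>, which suffices.\<close>
    show "(a * series_even (v 1) + b * series_even (v 0)) $ i = 0" if "i < m" for i
    proof (rule rel[where T = "\<lambda>j. series_even (v j)" and N = "m - 1"])
      show "series_even (v (Suc (Suc j))) $ i =
        (series_even (v j) + fps_const (d j) * (fps_X * series_even (v (Suc j)))) $ i"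
        if "i \<le> m - 1" for i j
        unfolding d_def using series_even_step[OF edge edge that _ \<open>2 \<le> n\<close>] m by simp
    qed (use per that in auto)
  \<comment> \<open>With \<open>v 0\<close> a point and \<open>v 1\<close> a line, the constant
    terms form the identity matrix.\<close>
  qed (use \<open>is_point (v 0)\<close> line in \<open>auto simp: series_odd_def series_even_def\<close>)
  then show False
    using top \<open>\<And>j. d j \<noteq> 0\<close> by simp
qed

lemma D_cycle_length:
  assumes c: "is_cycle (D n TYPE('a::{field,finite})) c" and n: "2 \<le> n"
  shows "even (length c)" "n + 4 \<le> length c"
proof -
  define L where "L = length c"
  \<comment> \<open>Periodic extension turns the cycle into an infinite closed walk.\<close>
  define v where "v i = c ! (i mod L)" for i
  have L: "3 \<le> L" and dist: "distinct c"
    using c by (auto simp: is_cycle_def L_def)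
  have edge: "{v j, v (Suc j)} \<in> snd (D n TYPE('a))" for j
  proof -
    have "j mod L < L" using L by simp
    then have "{c ! (j mod L), c ! (Suc (j mod L) mod L)} \<in> snd (D n TYPE('a))"
      using c by (auto simp: is_cycle_def L_def)
    then show ?thesis by (simp add: v_def mod_Suc_eq)
  qed
  have per: "v (j + L) = v j" for j
    by (simp add: v_def)
  have nonback: "v j \<noteq> v (Suc (Suc j))" for j
  proof
    assume "v j = v (Suc (Suc j))"
    then have "j mod L = Suc (Suc j) mod L"
      using nth_eq_iff_index_eq[OF dist, of "j mod L" "Suc (Suc j) mod L"] L
      unfolding v_def L_def[symmetric] by simp
    then have "L dvd Suc (Suc j) - j"
      using mod_eq_dvd_iff_nat[of j "Suc (Suc j)" L] by simp
    then have "L dvd 2" by simp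
    then show False using L by (auto dest: dvd_imp_le)
  qed
  have parity: "is_point (v j) \<longleftrightarrow> (is_point (v 0) \<longleftrightarrow> even j)" for j
  proof (induction j)
    case (Suc j)
    then show ?case
      using D_edge_parity[OF edge[of j]] by auto
  qed simp
  show "even (length c)"
    using parity[of L] per[of 0] by (auto simp: L_def)
  then obtain m where m: "L = 2 * m"
    by (auto simp: L_def)
  have "n + 4 \<le> 2 * m"
  proof (cases "is_point (v 0)")
    case True
    have "0 < m" using m L by simp
    then show ?thesis
      using D_no_short_closed_walk[OF edge nonback per[unfolded m] True] n by blast
  next
    case False
    \<comment> \<open>Shifting by one makes the walk start at a point.\<close>
    define w where "w j = v (Suc j)" for j
    have "{w j, w (Suc j)} \<in> snd (D n TYPE('a))" "w j \<noteq> w (Suc (Suc j))" "w (j + 2 * m) = w j" for j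
      using edge nonback per[of "Suc j", unfolded m] by (auto simp only: w_def add_Suc)
    moreover have "is_point (w 0)"
      using parity[of 1] False by (simp add: w_def)
    moreover have "0 < m"
      using m L by simp
    ultimately show ?thesis
      using D_no_short_closed_walk[of w n m] n by blast
  qed
  then show "n + 4 \<le> length c"
    using m by (simp add: L_def)
qed

section \<open>Existence of cycles\<close>

text \<open>A longest path cannot be extended, so every neighbour of its first vertex lies on it;
  one other than the second vertex closes a cycle.\<close>

lemma exists_cycle:
  fixes G :: "'v graph"
  assumes simple: "simple_graph G" and fin: "finite (fst G)" and ne: "fst G \<noteq> {}"
    and nbr: "\<And>v. v \<in> fst G \<Longrightarrow> \<exists>u w. u \<noteq> w \<and> {v, u} \<in> snd G \<and> {v, w} \<in> snd G"
  shows "\<exists>c. is_cycle G c"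
proof -
  define path where "path xs \<longleftrightarrow> xs \<noteq> [] \<and> distinct xs \<and> set xs \<subseteq> fst G \<and>
    (\<forall>i. Suc i < length xs \<longrightarrow> {xs ! i, xs ! Suc i} \<in> snd G)" for xs
  obtain v0 where "v0 \<in> fst G" using ne by blast
  then have "path [v0]" by (simp add: path_def)
  moreover have "length xs < Suc (card (fst G))" if "path xs" for xs
    using that card_mono[OF fin, of "set xs"] distinct_card[of xs] by (auto simp: path_def)
  ultimately obtain xs where xs: "path xs" and longest: "\<And>ys. path ys \<Longrightarrow> length ys \<le> length xs"
    using ex_has_greatest_nat[of path "[v0]" length] by blast
  have "hd xs \<in> fst G" using xs by (auto simp: path_def)
  then obtain u where u: "{hd xs, u} \<in> snd G" "Suc 0 < length xs \<longrightarrow> u \<noteq> xs ! 1"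
    using nbr[of "hd xs"] by metis
  have "card {hd xs, u} = 2" "u \<in> fst G" using simple u by (auto simp: simple_graph_def)
  have "u \<in> set xs"
  proof (rule ccontr)
    assume "u \<notin> set xs"
    have "{(u # xs) ! i, (u # xs) ! Suc i} \<in> snd G" if "Suc i < length (u # xs)" for i
      using that xs u by (cases i) (auto simp: path_def hd_conv_nth insert_commute)
    then have "path (u # xs)"
      using xs \<open>u \<notin> set xs\<close> \<open>u \<in> fst G\<close> by (auto simp: path_def)
    then show False using longest by force
  qed
  then obtain k where k: "k < length xs" "u = xs ! k" by (auto simp: in_set_conv_nth)
  \<comment> \<open>There are no loops, and \<open>u\<close> is not the second vertex, so the prefix
    ending in \<open>u\<close> has at least three vertices.\<close>
  have "k \<noteq> 0"
    using \<open>card {hd xs, u} = 2\<close> k by (intro notI) (auto simp: hd_conv_nth)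
  moreover have "k \<noteq> 1" using k u by auto
  ultimately have "2 \<le> k" by simp
  let ?c = "take (Suc k) xs"
  have "{?c ! i, ?c ! (Suc i mod length ?c)} \<in> snd G" if "i < length ?c" for i
  proof (cases "i = k")
    case True
    then show ?thesis using k u xs by (auto simp: hd_conv_nth insert_commute path_def)
  next
    case False
    then show ?thesis using that k xs by (auto simp: path_def)
  qed
  then have "is_cycle G ?c"
    using xs k \<open>2 \<le> k\<close> set_take_subset[of "Suc k" xs] by (auto simp: is_cycle_def path_def)
  then show ?thesis ..
qed

lemma exists_incident_line: "\<exists>l\<in>tuples n. incident n p l \<and> (1 \<le> n \<longrightarrow> l 1 = x)"
proof (induction n)
  case 0
  then show ?case by (auto simp: tuples_def incident_def)
next
  case (Suc n)
  then obtain l where l: "l \<in> tuples n" "incident n p l" "1 \<le> n \<longrightarrow> l 1 = x" by blast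
  \<comment> \<open>The first coordinate is prescribed; each later one is forced by its
    equation.\<close>
  define y where "y = (if n = 0 then x else rhs p l (Suc n) - p (Suc n))"
  have "rhs p (l(Suc n := y)) j = rhs p l j" if "2 \<le> j" "j \<le> Suc n" for j
    using that by (intro rhs_cong) auto
  moreover have "p j + (l(Suc n := y)) j = rhs p l j" if "2 \<le> j" "j \<le> Suc n" for j
    using that l(2) by (auto simp: incident_iff y_def le_Suc_eq)
  ultimately have "incident (Suc n) p (l(Suc n := y))"
    by (simp add: incident_iff)
  moreover have "l(Suc n := y) \<in> tuples (Suc n)"
    using l(1) by (auto simp: tuples_def PiE_iff extensional_def)
  moreover have "1 \<le> Suc n \<longrightarrow> (l(Suc n := y)) 1 = x"
    using l(3) by (simp add: y_def)
  ultimately show ?case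
    by blast
qed

lemma exists_incident_point: "\<exists>p\<in>tuples n. incident n p l \<and> (1 \<le> n \<longrightarrow> p 1 = x)"
proof (induction n)
  case 0
  then show ?case by (auto simp: tuples_def incident_def)
next
  case (Suc n)
  then obtain p where p: "p \<in> tuples n" "incident n p l" "1 \<le> n \<longrightarrow> p 1 = x" by blast
  define y where "y = (if n = 0 then x else rhs p l (Suc n) - l (Suc n))"
  have "rhs (p(Suc n := y)) l j = rhs p l j" if "2 \<le> j" "j \<le> Suc n" for j
    using that by (intro rhs_cong) auto
  moreover have "(p(Suc n := y)) j + l j = rhs p l j" if "2 \<le> j" "j \<le> Suc n" for j
    using that p(2) by (auto simp: incident_iff y_def le_Suc_eq)
  ultimately have "incident (Suc n) (p(Suc n := y)) l"
    by (simp add: incident_iff)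
  moreover have "p(Suc n := y) \<in> tuples (Suc n)"
    using p(1) by (auto simp: tuples_def PiE_iff extensional_def)
  moreover have "1 \<le> Suc n \<longrightarrow> (p(Suc n := y)) 1 = x"
    using p(3) by (simp add: y_def)
  ultimately show ?case
    by blast
qed

lemma D_neighbour_exists:
  assumes "v \<in> fst (D n TYPE('a::{field,finite}))" "1 \<le> n"
  shows "\<exists>u. {v, u} \<in> snd (D n TYPE('a)) \<and> coord u 1 = x"
proof (cases v)
  case (Point p)
  then have "p \<in> tuples n" using assms by (auto simp: D_def)
  moreover obtain l where "l \<in> tuples n" "incident n p l" "l 1 = x"
    using exists_incident_line[of n p x] assms by blast
  ultimately show ?thesis
    using Point by (intro exI[of _ "Line l"]) (auto simp: D_edge_iff)
next
  case (Line l)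
  then have "l \<in> tuples n" using assms by (auto simp: D_def)
  moreover obtain p where "p \<in> tuples n" "incident n p l" "p 1 = x"
    using exists_incident_point[of n l x] assms by blast
  ultimately show ?thesis
    using Line by (intro exI[of _ "Point p"]) (auto simp: D_edge_iff)
qed

text \<open>First coordinates 0 and 1 give each vertex two distinct neighbours. A cycle is needed
  for the \<open>LEAST\<close> in the girth to be attained.\<close>

lemma D_has_cycle:
  assumes "1 \<le> n"
  shows "\<exists>c. is_cycle (D n TYPE('a::{field,finite})) c"
proof (rule exists_cycle[OF simple_graph_D])
  show "finite (fst (D n TYPE('a)))"
    by (auto simp: D_def tuples_def intro!: finite_PiE)
  have "(\<lambda>i\<in>{1..n}. 0) \<in> (tuples n :: (nat \<Rightarrow> 'a) set)"
    by (auto simp: tuples_def)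
  then show "fst (D n TYPE('a)) \<noteq> {}"
    by (auto simp: D_def)
  fix v assume v: "v \<in> fst (D n TYPE('a))"
  obtain u w where "{v, u} \<in> snd (D n TYPE('a))" "coord u 1 = 0"
    "{v, w} \<in> snd (D n TYPE('a))" "coord w 1 = 1"
    using D_neighbour_exists[OF v assms] by metis
  then show "\<exists>u w. u \<noteq> w \<and> {v, u} \<in> snd (D n TYPE('a)) \<and> {v, w} \<in> snd (D n TYPE('a))"
    by (metis zero_neq_one)
qed

theorem theorem2p4:
  fixes q n :: nat
  assumes "primepow q" and "CARD('a::{field,finite}) = q" and "n \<ge> 2"
  shows "(\<exists>c. is_cycle (D n TYPE('a)) c) \<and>
         (odd n \<longrightarrow> girth (D n TYPE('a)) \<ge> n + 5) \<and>
         (even n \<longrightarrow> girth (D n TYPE('a)) \<ge> n + 4)"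
proof -
  have ex: "\<exists>c. is_cycle (D n TYPE('a)) c"
    by (rule D_has_cycle) (use assms(3) in simp)
  then have "\<exists>k c. is_cycle (D n TYPE('a)) c \<and> length c = k"
    by blast
  from LeastI_ex[OF this] obtain c where "is_cycle (D n TYPE('a)) c" "length c = girth (D n TYPE('a))"
    unfolding girth_def by blast
  then have girth: "even (girth (D n TYPE('a)))" "n + 4 \<le> girth (D n TYPE('a))"
    using D_cycle_length assms(3) by metis+
  \<comment> \<open>The girth is even, while \<open>n + 4\<close> is odd for odd
    \<open>n\<close>.\<close>
  moreover have "n + 5 \<le> girth (D n TYPE('a))" if "odd n"
    using girth that by (cases "girth (D n TYPE('a)) = n + 4") auto
  ultimately show ?thesis
    using ex by blast
qed

end
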